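(* For every $d\geq 1$, every set belonging to $\mathfrak{A}_d$, the set algebra of subsets of $\mathbb{R}^d$ generated by the semigroups in $\mathbb{R}^d$, is Erdős–Hajnal.
   Context: A semigroup in $\mathbb{R}^d$ is a subset of $\mathbb{R}^d$ closed under (vector) addition. $\mathfrak{A}_d$ is the smallest family of subsets of $\mathbb{R}^d$ that contains every semigroup and is closed under complement, finite union and finite intersection. For $S\subset\mathbb{R}^d$ and a finite $V\subset\mathbb{R}^d$, $\Gamma^S(V)$ is the digraph with vertex set $V$ in which, for distinct $x,y\in V$, $(x,y)$ is an edge iff $y-x\in S$ (loops are disregarded; both $(x,y)$ and $(y,x)$ may be edges). A vertex subset $W\subset V$ induces: a complete graph if $(u,v)$ is an edge for all ordered pairs of distinct $u,v\in W$; an independent set if no such pair is an edge; a transitive tournament if $W$ can be enumerated $w_1,\dots,w_k$ so that $(w_i,w_j)$ is an edge iff $i<j$. The set $S$ is called Erdős–Hajnal if there exist $\epsilon>0$ and $c>0$ such that, for every finite $V\subset\mathbb{R}^d$ with $|V|=n$, there is $W\subset V$ with $|W|\geq c\,n^{\epsilon}$ inducing in $\Gamma^S(V)$ a complete graph, an independent set, or a transitive tournament. *)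

theory Defs
  imports "HOL-Analysis.Analysis" "Graph_Theory.Pair_Digraph"
begin

text \<open>Not required to be nonempty: the empty set is a semigroup.\<close>

definition is_semigroup :: "'a::plus set \<Rightarrow> bool" where
  "is_semigroup S \<longleftrightarrow> (\<forall>x\<in>S. \<forall>y\<in>S. x + y \<in> S)"

inductive_set semigroup_algebra :: "'a::plus set set" where
  semigroup: "is_semigroup S \<Longrightarrow> S \<in> semigroup_algebra"
| compl: "A \<in> semigroup_algebra \<Longrightarrow> - A \<in> semigroup_algebra"
| union: "A \<in> semigroup_algebra \<Longrightarrow> B \<in> semigroup_algebra \<Longrightarrow> A \<union> B \<in> semigroup_algebra"
| inter: "A \<in> semigroup_algebra \<Longrightarrow> B \<in> semigroup_algebra \<Longrightarrow> A \<inter> B \<in> semigroup_algebra"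

definition difference_digraph :: "'a::minus set \<Rightarrow> 'a set \<Rightarrow> 'a pair_pre_digraph" where
  "difference_digraph S V =
     \<lparr> pverts = V, parcs = {(x, y). x \<in> V \<and> y \<in> V \<and> x \<noteq> y \<and> y - x \<in> S} \<rparr>"

definition induces_complete :: "'a pair_pre_digraph \<Rightarrow> 'a set \<Rightarrow> bool" where
  "induces_complete G W \<longleftrightarrow> (\<forall>u\<in>W. \<forall>v\<in>W. u \<noteq> v \<longrightarrow> (u, v) \<in> parcs G)"

definition induces_independent :: "'a pair_pre_digraph \<Rightarrow> 'a set \<Rightarrow> bool" where
  "induces_independent G W \<longleftrightarrow> (\<forall>u\<in>W. \<forall>v\<in>W. u \<noteq> v \<longrightarrow> (u, v) \<notin> parcs G)"

definition induces_transitive_tournament :: "'a pair_pre_digraph \<Rightarrow> 'a set \<Rightarrow> bool" where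
  "induces_transitive_tournament G W \<longleftrightarrow>
     (\<exists>ws. distinct ws \<and> set ws = W \<and>
        (\<forall>i<length ws. \<forall>j<length ws. (ws ! i, ws ! j) \<in> parcs G \<longleftrightarrow> i < j))"

definition erdos_hajnal :: "'a::minus set \<Rightarrow> bool" where
  "erdos_hajnal S \<longleftrightarrow>
     (\<exists>\<epsilon>::real. \<exists>c::real. \<epsilon> > 0 \<and> c > 0 \<and>
        (\<forall>V. finite V \<longrightarrow>
           (\<exists>W\<subseteq>V. real (card W) \<ge> c * real (card V) powr \<epsilon> \<and>
              (let G = difference_digraph S V in
                 induces_complete G W \<or> induces_independent G W \<or>
                 induces_transitive_tournament G W))))"

end

theory Submission
  imports Defs
begin

text \<open>
  Each semigroup \<open>S\<close> makes \<open>y - x \<in> S\<close> a transitive relation. Enumerate \<open>V\<close>; together with the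
  enumeration order, such a relation yields three partial orders (pairs related only forwards, only
  backwards, in both directions), and in each of them there is a chain or an antichain of size at
  least the square root. Applying this three times gives a subset of size at least
  \<open>n powr (1/8)\<close> on which the relation of a pair depends only on how the pair is ordered by the
  enumeration. This property passes to complements, and for unions and intersections one shrinks
  the subset twice, which multiplies the exponents.
\<close>

section \<open>Homogeneous subsets for transitive relations\<close>

definition order_homogeneous :: "('a::linorder \<Rightarrow> 'a \<Rightarrow> bool) \<Rightarrow> 'a set \<Rightarrow> bool" where
  "order_homogeneous R B \<longleftrightarrow>
     (\<exists>a b. \<forall>i\<in>B. \<forall>j\<in>B. i < j \<longrightarrow> (R i j \<longleftrightarrow> a) \<and> (R j i \<longleftrightarrow> b))"

lemma order_homogeneous_subset:
  assumes "order_homogeneous R A" "B \<subseteq> A"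
  shows "order_homogeneous R B"
proof -
  obtain a b where "\<forall>i\<in>A. \<forall>j\<in>A. i < j \<longrightarrow> (R i j \<longleftrightarrow> a) \<and> (R j i \<longleftrightarrow> b)"
    using assms(1) unfolding order_homogeneous_def by (elim exE)
  then have "\<forall>i\<in>B. \<forall>j\<in>B. i < j \<longrightarrow> (R i j \<longleftrightarrow> a) \<and> (R j i \<longleftrightarrow> b)"
    using assms(2) by (simp add: subset_iff)
  then show ?thesis unfolding order_homogeneous_def by (intro exI)
qed

text \<open>Mirsky's argument. The sets on which \<open>f\<close>, the largest size of a chain
  ending at a given point, is constant are antichains. With \<open>m\<close> the largest value of
  \<open>f\<close> and \<open>L\<close> the largest size of a level,
  \<open>card A \<le> m * L\<close>, so \<open>m\<close> and \<open>L\<close> cannot both have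
  squares below \<open>card A\<close>.\<close>

lemma exists_chain_or_antichain:
  fixes A :: "'a::linorder set"
  assumes fin: "finite A"
    and trans: "\<And>i j k. i < j \<Longrightarrow> j < k \<Longrightarrow> T i j \<Longrightarrow> T j k \<Longrightarrow> T i k"
  shows "\<exists>B\<subseteq>A. card A \<le> card B ^ 2 \<and>
           ((\<forall>i\<in>B. \<forall>j\<in>B. i < j \<longrightarrow> T i j) \<or> (\<forall>i\<in>B. \<forall>j\<in>B. i < j \<longrightarrow> \<not> T i j))"
proof -
  define chain where "chain C \<longleftrightarrow> (\<forall>i\<in>C. \<forall>j\<in>C. i < j \<longrightarrow> T i j)" for C
  define Ch where "Ch x = {C. C \<subseteq> A \<and> x \<in> C \<and> (\<forall>y\<in>C. y \<le> x) \<and> chain C}" for x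
  \<comment> \<open>Outside \<open>A\<close> the family \<open>Ch x\<close> is empty and this
    maximum is unspecified, so \<open>f\<close> is only ever evaluated usefully on
    \<open>A\<close>.\<close>
  define f where "f x = Max (card ` Ch x)" for x
  have finCh: "finite (Ch x)" for x
    unfolding Ch_def using fin by simp
  have single: "{x} \<in> Ch x" if "x \<in> A" for x
    using that by (auto simp: Ch_def chain_def)
  have attained: "\<exists>C\<in>Ch x. card C = f x" if "x \<in> A" for x
  proof -
    have "f x \<in> card ` Ch x"
      unfolding f_def using finCh single[OF that] by (intro Max_in) auto
    then show ?thesis by auto
  qed
  \<comment> \<open>By transitivity, a longest chain ending at \<open>i\<close> can be prolonged by
    \<open>j\<close>.\<close>
  have strict: "f i < f j" if "i \<in> A" and "j \<in> A" "i < j" "T i j" for i j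
  proof -
    obtain C where C: "C \<in> Ch i" "card C = f i" using attained[OF \<open>i \<in> A\<close>] by blast
    have "T y j" if "y \<in> C" for y
    proof (cases "y = i")
      case False
      then have "y < i" "T y i" using C that by (auto simp: Ch_def chain_def order_less_le)
      then show ?thesis using trans \<open>i < j\<close> \<open>T i j\<close> by blast
    qed (use \<open>T i j\<close> in simp)
    moreover have lt: "y < j" if "y \<in> C" for y
      using C that \<open>i < j\<close> by (auto simp: Ch_def)
    ultimately have "insert j C \<in> Ch j"
      using C \<open>j \<in> A\<close> by (auto simp: Ch_def chain_def dest: order_less_asym intro: less_imp_le)
    then have "card (insert j C) \<le> f j"
      unfolding f_def using finCh by simp
    moreover have "j \<notin> C" "finite C"
      using lt C fin finite_subset by (auto simp: Ch_def)
    ultimately show ?thesis using C by simp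
  qed
  show ?thesis
  proof (cases "\<exists>B\<subseteq>A. card A \<le> card B ^ 2 \<and> chain B")
    case True
    then show ?thesis unfolding chain_def by blast
  next
    case no_chain: False
    show ?thesis
    proof (rule ccontr)
      assume neg: "\<not> ?thesis"
      have level: "(card {x\<in>A. f x = l})\<^sup>2 < card A" for l
      proof (rule ccontr)
        assume "\<not> ?thesis"
        then have "{x\<in>A. f x = l} \<subseteq> A" "card A \<le> (card {x\<in>A. f x = l})\<^sup>2" by auto
        moreover have "\<forall>i\<in>{x\<in>A. f x = l}. \<forall>j\<in>{x\<in>A. f x = l}. i < j \<longrightarrow> \<not> T i j"
          using strict by fastforce
        ultimately show False
          using neg by blast
      qed
      have height: "(f x)\<^sup>2 < card A" if "x \<in> A" for x
      proof -
        obtain C where "C \<in> Ch x" "card C = f x" using attained[OF \<open>x \<in> A\<close>] by blast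
        moreover from this have "C \<subseteq> A" "chain C" by (auto simp: Ch_def)
        ultimately show ?thesis using no_chain by (metis not_le)
      qed
      have "A \<noteq> {}" using level[of 0] by auto
      define m where "m = Max (f ` A)"
      define L where "L = Max ((\<lambda>l. card {x\<in>A. f x = l}) ` f ` A)"
      have "m \<in> f ` A" unfolding m_def using fin \<open>A \<noteq> {}\<close> by (intro Max_in) auto
      then have m: "m\<^sup>2 < card A" using height by auto
      have "L \<in> (\<lambda>l. card {x\<in>A. f x = l}) ` f ` A"
        unfolding L_def using fin \<open>A \<noteq> {}\<close> by (intro Max_in) auto
      then have L: "L\<^sup>2 < card A" using level by auto
      \<comment> \<open>Excluding the value 0 leaves at most \<open>m\<close> levels instead of
        \<open>m + 1\<close>, which the final product bound relies on.\<close>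
      have "f x \<ge> 1" if "x \<in> A" for x
      proof -
        have "card {x} \<le> f x"
          unfolding f_def by (intro Max_ge imageI finite_imageI finCh single that)
        then show ?thesis by simp
      qed
      then have img: "f ` A \<subseteq> {1..m}" unfolding m_def using fin by auto
      have "card A = (\<Sum>l\<in>f ` A. card {x\<in>A. f x = l})"
        using sum.image_gen[OF fin, of "\<lambda>_. 1::nat" f] by simp
      also have "\<dots> \<le> (\<Sum>l\<in>f ` A. L)"
        unfolding L_def using fin by (intro sum_mono Max_ge) auto
      also have "\<dots> \<le> m * L"
        using card_mono[OF _ img] by simp
      also have "\<dots> \<le> (max m L)\<^sup>2"
        unfolding power2_eq_square by (intro mult_mono) auto
      finally show False using m L by (auto simp: max_def split: if_splits)
    qed
  qed
qed

text \<open>The exponent is 8 because a square root is lost for each of the three relations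
  \<open>F\<close>, \<open>G\<close> and \<open>H\<close>.\<close>

lemma transitive_exists_order_homogeneous:
  fixes A :: "'a::linorder set"
  assumes fin: "finite A"
    and trans: "\<And>i j k. i \<noteq> k \<Longrightarrow> R i j \<Longrightarrow> R j k \<Longrightarrow> R i k"
  shows "\<exists>B\<subseteq>A. card A \<le> card B ^ 8 \<and> order_homogeneous R B"
proof -
  define only where "only T B \<longleftrightarrow> (\<forall>i\<in>B. \<forall>j\<in>B. i < j \<longrightarrow> T i j)"
    for T :: "'a \<Rightarrow> 'a \<Rightarrow> bool" and B
  have step: "\<exists>B\<subseteq>A'. card A' \<le> card B ^ 2 \<and> (only T B \<or> only (\<lambda>i j. \<not> T i j) B)"
    if "A' \<subseteq> A" "\<And>i j k. i < j \<Longrightarrow> j < k \<Longrightarrow> T i j \<Longrightarrow> T j k \<Longrightarrow> T i k" for A' T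
    unfolding only_def
    by (rule exists_chain_or_antichain) (use that fin finite_subset in blast)+
  have only_subset: "only T B" if "only T C" "B \<subseteq> C" for T B C
    using that unfolding only_def by blast
  define F where "F i j \<longleftrightarrow> R i j \<and> \<not> R j i" for i j
  define G where "G i j \<longleftrightarrow> R j i \<and> \<not> R i j" for i j
  define H where "H i j \<longleftrightarrow> R i j \<and> R j i" for i j
  have F: "F i k" if "i < j" "j < k" "F i j" "F j k" for i j k
    \<comment> \<open>If \<open>R k i\<close> held, then with \<open>R i j\<close> it would give
      \<open>R k j\<close>, against \<open>F j k\<close>. The argument for \<open>G\<close> is the
      mirror image.\<close>
    using that trans unfolding F_def by (metis order_less_asym order_less_trans order_less_irrefl)
  have G: "G i k" if "i < j" "j < k" "G i j" "G j k" for i j k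
    using that trans unfolding G_def by (metis order_less_asym order_less_trans order_less_irrefl)
  have H: "H i k" if "i < j" "j < k" "H i j" "H j k" for i j k
    using that trans unfolding H_def by (metis order_less_asym order_less_trans order_less_irrefl)
  obtain B1 where B1: "B1 \<subseteq> A" "card A \<le> card B1 ^ 2" "only F B1 \<or> only (\<lambda>i j. \<not> F i j) B1"
    using step[of A F] F by blast
  obtain B2 where B2: "B2 \<subseteq> B1" "card B1 \<le> card B2 ^ 2" "only G B2 \<or> only (\<lambda>i j. \<not> G i j) B2"
    using step[of B1 G] G B1 by blast
  obtain B3 where B3: "B3 \<subseteq> B2" "card B2 \<le> card B3 ^ 2" "only H B3 \<or> only (\<lambda>i j. \<not> H i j) B3"
    using step[of B2 H] H B1 B2 by blast
  have "card A \<le> (card B1)\<^sup>2" by (fact B1)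
  also have "\<dots> \<le> ((card B2)\<^sup>2)\<^sup>2" by (intro power_mono B2) simp
  also have "\<dots> \<le> (((card B3)\<^sup>2)\<^sup>2)\<^sup>2" by (intro power_mono B3) simp_all
  finally have "card A \<le> card B3 ^ 8" by (simp flip: power_mult)
  moreover have "order_homogeneous R B3"
  proof -
    have hom: "order_homogeneous R B3"
      if "\<And>i j. i \<in> B3 \<Longrightarrow> j \<in> B3 \<Longrightarrow> i < j \<Longrightarrow> (R i j \<longleftrightarrow> a) \<and> (R j i \<longleftrightarrow> b)" for a b
      unfolding order_homogeneous_def
      by (rule exI[of _ a], rule exI[of _ b]) (use that in simp)
    have F3: "only F B3 \<or> only (\<lambda>i j. \<not> F i j) B3"
      using B1(3) only_subset B2(1) B3(1) by (meson order_trans)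
    have G3: "only G B3 \<or> only (\<lambda>i j. \<not> G i j) B3"
      using B2(3) only_subset B3(1) by blast
    \<comment> \<open>\<open>F\<close>, \<open>G\<close> and \<open>H\<close> exhaust the ways in
      which \<open>R\<close> can hold between two points, so where all three fail, \<open>R\<close>
      fails in both directions.\<close>
    consider "only F B3" | "only G B3" | "only H B3"
      | "only (\<lambda>i j. \<not> F i j) B3" "only (\<lambda>i j. \<not> G i j) B3" "only (\<lambda>i j. \<not> H i j) B3"
      using F3 G3 B3(3) by blast
    then show ?thesis
    proof cases
      case 1
      then show ?thesis by (intro hom[of True False]) (auto simp: only_def F_def)
    next
      case 2
      then show ?thesis by (intro hom[of False True]) (auto simp: only_def G_def)
    next
      case 3
      then show ?thesis by (intro hom[of True True]) (auto simp: only_def H_def)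
    next
      case 4
      then show ?thesis by (intro hom[of False False]) (auto simp: only_def F_def G_def H_def)
    qed
  qed
  ultimately show ?thesis using B1 B2 B3 by blast
qed

section \<open>Closure under the operations of the set algebra\<close>

text \<open>The bound says that \<open>B\<close> has size at least the \<open>k\<close>-th root of
  \<open>card A\<close>, without real exponents. Quantifying over index sets \<open>A\<close> for a
  fixed \<open>v\<close> allows one set after another to be treated while the enumeration stays the
  same.\<close>

definition polynomially_homogeneous :: "'a::minus set \<Rightarrow> bool" where
  "polynomially_homogeneous S \<longleftrightarrow>
     (\<exists>k>0. \<forall>(v :: nat \<Rightarrow> 'a) A. finite A \<longrightarrow>
        (\<exists>B\<subseteq>A. card A \<le> card B ^ k \<and> order_homogeneous (\<lambda>i j. v j - v i \<in> S) B))"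

text \<open>Differences telescope, so closure under addition is transitivity of the
  relation.\<close>

lemma semigroup_polynomially_homogeneous:
  fixes S :: "'a::ab_group_add set"
  assumes "is_semigroup S"
  shows "polynomially_homogeneous S"
proof -
  have trans: "v k - v i \<in> S" if "v j - v i \<in> S" "v k - v j \<in> S"
    for v :: "nat \<Rightarrow> 'a" and i j k
  proof -
    have "(v j - v i) + (v k - v j) \<in> S" using assms that unfolding is_semigroup_def by blast
    then show ?thesis by simp
  qed
  have "\<exists>B\<subseteq>A. card A \<le> card B ^ 8 \<and> order_homogeneous (\<lambda>i j. v j - v i \<in> S) B"
    if "finite A" for v :: "nat \<Rightarrow> 'a" and A
    using that trans by (rule transitive_exists_order_homogeneous)
  then show ?thesis
    unfolding polynomially_homogeneous_def by (intro exI[of _ 8]) simp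
qed

lemma polynomially_homogeneous_Compl:
  "polynomially_homogeneous S \<Longrightarrow> polynomially_homogeneous (- S)"
proof -
  have "order_homogeneous (\<lambda>i j. v j - v i \<in> - S) B"
    if "order_homogeneous (\<lambda>i j. v j - v i \<in> S) B" for v :: "nat \<Rightarrow> 'a" and B
    using that unfolding order_homogeneous_def by (metis Compl_iff)
  then show "polynomially_homogeneous S \<Longrightarrow> polynomially_homogeneous (- S)"
    unfolding polynomially_homogeneous_def by meson
qed

text \<open>Here \<open>f\<close> is an arbitrary Boolean connective, which covers union and
  intersection at once. Homogeneity for \<open>S\<close> survives the second shrinking, made for
  \<open>T\<close>, and the truth values for \<open>U\<close> are then \<open>f a a'\<close> and
  \<open>f b b'\<close>.\<close>

lemma polynomially_homogeneous_combine:
  assumes "polynomially_homogeneous S" "polynomially_homogeneous T"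
    and comb: "\<And>x. x \<in> U \<longleftrightarrow> f (x \<in> S) (x \<in> T)"
  shows "polynomially_homogeneous U"
proof -
  obtain k where k: "k > 0" and S: "\<And>v A. finite A \<Longrightarrow>
      \<exists>B\<subseteq>A. card A \<le> card B ^ k \<and> order_homogeneous (\<lambda>i j::nat. v j - v i \<in> S) B"
    using assms(1) unfolding polynomially_homogeneous_def by blast
  obtain l where l: "l > 0" and T: "\<And>v A. finite A \<Longrightarrow>
      \<exists>B\<subseteq>A. card A \<le> card B ^ l \<and> order_homogeneous (\<lambda>i j::nat. v j - v i \<in> T) B"
    using assms(2) unfolding polynomially_homogeneous_def by blast
  have "\<exists>B\<subseteq>A. card A \<le> card B ^ (l * k) \<and> order_homogeneous (\<lambda>i j. v j - v i \<in> U) B"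
    if fin: "finite A" for v :: "nat \<Rightarrow> 'a" and A
  proof -
    obtain B where B: "B \<subseteq> A" "card A \<le> card B ^ k"
        "order_homogeneous (\<lambda>i j. v j - v i \<in> S) B"
      using S fin by blast
    obtain C where C: "C \<subseteq> B" "card B \<le> card C ^ l"
        "order_homogeneous (\<lambda>i j. v j - v i \<in> T) C"
      using T B fin finite_subset by metis
    have "card A \<le> (card C ^ l) ^ k"
      using B(2) power_mono[OF C(2), of k] by simp
    moreover obtain a b where ab: "\<forall>i\<in>C. \<forall>j\<in>C. i < j \<longrightarrow>
        (v j - v i \<in> S \<longleftrightarrow> a) \<and> (v i - v j \<in> S \<longleftrightarrow> b)"
      using order_homogeneous_subset[OF B(3) C(1)] unfolding order_homogeneous_def by metis
    moreover obtain a' b' where ab': "\<forall>i\<in>C. \<forall>j\<in>C. i < j \<longrightarrow>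
        (v j - v i \<in> T \<longleftrightarrow> a') \<and> (v i - v j \<in> T \<longleftrightarrow> b')"
      using C(3) unfolding order_homogeneous_def by metis
    have "order_homogeneous (\<lambda>i j. v j - v i \<in> U) C"
      unfolding order_homogeneous_def comb
      by (rule exI[of _ "f a a'"], rule exI[of _ "f b b'"]) (use ab ab' in simp)
    ultimately show ?thesis using B(1) C(1) by (intro exI[of _ C]) (auto simp: power_mult)
  qed
  then show ?thesis
    unfolding polynomially_homogeneous_def
    using k l by (intro exI[of _ "l * k"]) auto
qed

lemma semigroup_algebra_polynomially_homogeneous:
  fixes S :: "'a::ab_group_add set"
  assumes "S \<in> semigroup_algebra"
  shows "polynomially_homogeneous S"
  using assms
proof induction
  case (union A B)
  then show ?case
    using polynomially_homogeneous_combine[of A B "A \<union> B" "(\<or>)"] by simp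
next
  case (inter A B)
  then show ?case
    using polynomially_homogeneous_combine[of A B "A \<inter> B" "(\<and>)"] by simp
qed (simp_all add: semigroup_polynomially_homogeneous polynomially_homogeneous_Compl)

section \<open>From homogeneous index sets to the Erdos-Hajnal property\<close>

lemma transitive_tournament_of_index_order:
  fixes v :: "nat \<Rightarrow> 'a"
  assumes "finite B" "inj_on v B"
    and "\<And>i j. i \<in> B \<Longrightarrow> j \<in> B \<Longrightarrow> (v i, v j) \<in> parcs G \<longleftrightarrow> i < j"
  shows "induces_transitive_tournament G (v ` B)"
proof -
  let ?xs = "sorted_list_of_set B"
  have "(?xs ! i < ?xs ! j) \<longleftrightarrow> i < j" if "i < length ?xs" "j < length ?xs" for i j
    using that strict_sorted_list_of_set[of B]
    by (metis linorder_neqE_nat order_less_asym sorted_wrt_nth_less order_less_irrefl)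
  moreover have "?xs ! i \<in> B" if "i < length ?xs" for i
    using nth_mem[OF that] assms(1) by simp
  ultimately show ?thesis
    unfolding induces_transitive_tournament_def using assms
    by (intro exI[of _ "map v ?xs"]) (auto simp: distinct_map)
qed

text \<open>The reflection of indices \<open>i\<close> to \<open>N - i\<close> reduces this to the
  increasing case. As \<open>N\<close> bounds \<open>B\<close>, truncated subtraction is injective
  on \<open>B\<close> and undoes itself there.\<close>

lemma transitive_tournament_of_reverse_index_order:
  fixes v :: "nat \<Rightarrow> 'a"
  assumes "finite B" "inj_on v B"
    and arcs: "\<And>i j. i \<in> B \<Longrightarrow> j \<in> B \<Longrightarrow> (v i, v j) \<in> parcs G \<longleftrightarrow> j < i"
  shows "induces_transitive_tournament G (v ` B)"
proof -
  obtain N where N: "B \<subseteq> {..N}"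
    using assms(1) finite_nat_iff_bounded_le by blast
  have img: "(\<lambda>i. v (N - i)) ` (\<lambda>i. N - i) ` B = v ` B"
    using N by (auto simp: image_image subset_iff intro!: image_cong)
  have "induces_transitive_tournament G ((\<lambda>i. v (N - i)) ` (\<lambda>i. N - i) ` B)"
  proof (rule transitive_tournament_of_index_order)
    show "inj_on (\<lambda>i. v (N - i)) ((\<lambda>i. N - i) ` B)"
      using assms(2) N by (auto simp: inj_on_def subset_iff)
    show "(v (N - i), v (N - j)) \<in> parcs G \<longleftrightarrow> i < j"
      if im: "i \<in> (\<lambda>i. N - i) ` B" "j \<in> (\<lambda>i. N - i) ` B" for i j
    proof -
      obtain i' j' where ij: "i' \<in> B" "j' \<in> B" "i = N - i'" "j = N - j'"
        using im by blast
      moreover have "i' \<le> N" "j' \<le> N" using ij N by auto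
      ultimately show ?thesis using arcs[of i' j'] by auto
    qed
  qed (use assms(1) in simp)
  then show ?thesis by (simp add: img)
qed

text \<open>The four values of the pair \<open>a\<close>, \<open>b\<close> correspond to a complete
  graph, an independent set and the two orientations of a transitive tournament. The constants are
  \<open>1 / k\<close> for the exponent and 1 for the factor.\<close>

lemma polynomially_homogeneous_imp_erdos_hajnal:
  fixes S :: "'a::minus set"
  assumes "polynomially_homogeneous S"
  shows "erdos_hajnal S"
proof -
  obtain k where k: "k > 0" and S: "\<And>v A. finite A \<Longrightarrow>
      \<exists>B\<subseteq>A. card A \<le> card B ^ k \<and> order_homogeneous (\<lambda>i j::nat. v j - v i \<in> S) B"
    using assms unfolding polynomially_homogeneous_def by blast
  have large: "\<exists>W\<subseteq>V. 1 * real (card V) powr (1 / real k) \<le> real (card W) \<and>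
      (let G = difference_digraph S V in induces_complete G W \<or> induces_independent G W \<or>
        induces_transitive_tournament G W)" if fin: "finite V" for V
  proof -
    obtain v where v: "bij_betw v {0..<card V} V"
      using ex_bij_betw_nat_finite[OF fin] by blast
    obtain B where B: "B \<subseteq> {0..<card V}" "card V \<le> card B ^ k"
        "order_homogeneous (\<lambda>i j. v j - v i \<in> S) B"
      using S[of "{0..<card V}" v] by auto
    have finB: "finite B" using B finite_subset by blast
    have inj: "inj_on v B" using v B by (meson bij_betw_def inj_on_subset)
    have sub: "v ` B \<subseteq> V" using v B by (auto simp: bij_betw_def)
    have "real (card V) powr (1 / real k) \<le> (real (card B) ^ k) powr (1 / real k)"
      using B(2) by (intro powr_mono2) (auto simp flip: of_nat_power)
    \<comment> \<open>An empty \<open>B\<close> is treated apart: \<open>powr_realpow\<close>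
      requires a positive base, whereas here both sides are 0 because \<open>k > 0\<close> and
      \<open>0 powr x = 0\<close>.\<close>
    also have "\<dots> = real (card B)"
      using k by (cases "card B = 0") (simp_all add: powr_powr flip: powr_realpow)
    finally have size: "1 * real (card V) powr (1 / real k) \<le> real (card (v ` B))"
      using card_image[OF inj] by simp
    let ?G = "difference_digraph S V"
    have arcs: "(v i, v j) \<in> parcs ?G \<longleftrightarrow> i \<noteq> j \<and> v j - v i \<in> S" if "i \<in> B" "j \<in> B" for i j
      using that sub inj by (auto simp: difference_digraph_def inj_on_def)
    obtain a b where ab: "\<And>i j. i \<in> B \<Longrightarrow> j \<in> B \<Longrightarrow> i < j \<Longrightarrow>
        (v j - v i \<in> S \<longleftrightarrow> a) \<and> (v i - v j \<in> S \<longleftrightarrow> b)"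
      using B(3) unfolding order_homogeneous_def by metis
    \<comment> \<open>The form of the \<open>else\<close> branch makes the diagonal
      \<open>i = j\<close> false, since loops are never arcs.\<close>
    have arc_iff: "(v i, v j) \<in> parcs ?G \<longleftrightarrow> (if i < j then a else j < i \<and> b)"
      if "i \<in> B" "j \<in> B" for i j
      using arcs[OF that] ab that by (metis linorder_neqE_nat order_less_asym)
    consider "a \<and> b" | "\<not> a \<and> \<not> b" | "a \<and> \<not> b" | "\<not> a \<and> b" by blast
    then have "induces_complete ?G (v ` B) \<or> induces_independent ?G (v ` B) \<or>
        induces_transitive_tournament ?G (v ` B)"
    proof cases
      case 1
      then have "induces_complete ?G (v ` B)"
        unfolding induces_complete_def by (auto simp: arc_iff) (metis linorder_neqE_nat)
      then show ?thesis by blast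
    next
      case 2
      then have "induces_independent ?G (v ` B)"
        unfolding induces_independent_def by (auto simp: arc_iff)
      then show ?thesis by blast
    next
      case 3
      then show ?thesis
        using transitive_tournament_of_index_order[OF finB inj] arc_iff by auto
    next
      case 4
      then show ?thesis
        using transitive_tournament_of_reverse_index_order[OF finB inj] arc_iff by auto
    qed
    with sub size show ?thesis by (auto simp: Let_def)
  qed
  show ?thesis
    unfolding erdos_hajnal_def
    by (intro exI[of _ "1 / real k"] exI[of _ "1::real"] conjI allI impI large) (use k in simp_all)
qed

theorem mainTheorem3:
  fixes S :: "(real ^ 'd) set"
  assumes "S \<in> semigroup_algebra"
  shows "erdos_hajnal S"
  using assms
  by (intro polynomially_homogeneous_imp_erdos_hajnal semigroup_algebra_polynomially_homogeneous)

end
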